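(* On an ACYT 8-manifold with closed torsion, $dT=0$ (a strong ACYT 8-manifold), the Nijenhuis tensor is parallel with respect to the torsion connection, $\nabla N=0$.
   Context: An ACYT (almost Calabi-Yau with torsion) 8-manifold $(M,g,J,\Psi)$ is an almost Hermitian manifold $(M,g,J)$ of real dimension 8 with a nowhere vanishing $(4,0)$-form $\Psi$ of constant norm (an $SU(4)$-structure) admitting a (necessarily unique) linear connection $\nabla$, the torsion connection, with $\nabla g=\nabla J=\nabla\Psi=0$ and totally skew-symmetric torsion $T(X,Y,Z)=g(\nabla_XY-\nabla_YX-[X,Y],Z)$. $N$ is the Nijenhuis tensor of $J$, regarded as a $(0,3)$-tensor via $g$. *)

theory Defs
  imports "HOL-Analysis.Analysis" "HOL-Library.Function_Algebras"
begin

section \<open>Smooth manifolds\<close>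

text \<open>\<open>Ck_on k S\<close> is only meaningful for open \<open>S\<close>, where it is the usual class \<open>C\<^sup>k\<close>: as the domain is
  finite-dimensional, continuity of the directional derivatives suffices.\<close>

primrec Ck_on :: "nat \<Rightarrow> 'e::euclidean_space set \<Rightarrow> ('e \<Rightarrow> 'f::real_normed_vector) \<Rightarrow> bool" where
  "Ck_on 0 S f \<longleftrightarrow> continuous_on S f"
| "Ck_on (Suc k) S f \<longleftrightarrow> (\<forall>x\<in>S. f differentiable (at x)) \<and>
     (\<forall>v. Ck_on k S (\<lambda>x. frechet_derivative f (at x) v))"

definition smooth_on :: "'e::euclidean_space set \<Rightarrow> ('e \<Rightarrow> 'f::real_normed_vector) \<Rightarrow> bool" where
  "smooth_on S f \<longleftrightarrow> (\<forall>k. Ck_on k S f)"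

text \<open>A chart is a pair of its domain and its coordinate map.\<close>

type_synonym ('a, 'e) chart = "'a set \<times> ('a \<Rightarrow> 'e)"

definition chart_image :: "('a, 'e) chart \<Rightarrow> 'e set" where
  "chart_image c = snd c ` fst c"

definition chart_inv :: "('a, 'e) chart \<Rightarrow> 'e \<Rightarrow> 'a" where
  "chart_inv c = inv_into (fst c) (snd c)"

definition is_chart :: "('a::topological_space, 'e::euclidean_space) chart \<Rightarrow> bool" where
  "is_chart c \<longleftrightarrow> open (fst c) \<and> open (chart_image c) \<and>
     homeomorphism (fst c) (chart_image c) (snd c) (chart_inv c)"

text \<open>The manifold is the whole type. The atlas need not be maximal.\<close>

definition smooth_atlas ::
  "('a::{t2_space, second_countable_topology}, 'e::euclidean_space) chart set \<Rightarrow> bool" where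
  "smooth_atlas A \<longleftrightarrow> (\<forall>c\<in>A. is_chart c) \<and> (\<Union>c\<in>A. fst c) = UNIV \<and>
     (\<forall>c\<in>A. \<forall>d\<in>A. smooth_on (snd c ` (fst c \<inter> fst d)) (snd d \<circ> chart_inv c))"

definition smooth_funs :: "('a, 'e::euclidean_space) chart set \<Rightarrow> ('a \<Rightarrow> real) set" where
  "smooth_funs A = {f. \<forall>c\<in>A. smooth_on (chart_image c) (f \<circ> chart_inv c)}"

section \<open>Tangent vectors and vector fields\<close>

text \<open>Tangent vectors at a point are derivations at that point of the algebra of smooth functions.
  Being total functions in HOL, they are required to vanish on non-smooth arguments, so that
  equality of tangent vectors is HOL equality. Sums, differences and products of functions are
  pointwise (\<^theory>\<open>HOL-Library.Function_Algebras\<close>).\<close>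

type_synonym 'a tvec = "('a \<Rightarrow> real) \<Rightarrow> real"
type_synonym 'a vfield = "'a \<Rightarrow> 'a tvec"

definition tangent_space :: "('a, 'e::euclidean_space) chart set \<Rightarrow> 'a \<Rightarrow> 'a tvec set" where
  "tangent_space A p = {v.
     (\<forall>f\<in>smooth_funs A. \<forall>h\<in>smooth_funs A. v (f + h) = v f + v h) \<and>
     (\<forall>a. \<forall>f\<in>smooth_funs A. v (\<lambda>q. a * f q) = a * v f) \<and>
     (\<forall>f\<in>smooth_funs A. \<forall>h\<in>smooth_funs A. v (f * h) = f p * v h + h p * v f) \<and>
     (\<forall>f. f \<notin> smooth_funs A \<longrightarrow> v f = 0)}"

definition tscale :: "real \<Rightarrow> 'a tvec \<Rightarrow> 'a tvec" where
  "tscale a v = (\<lambda>f. a * v f)"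

definition fscale :: "('a \<Rightarrow> real) \<Rightarrow> 'a vfield \<Rightarrow> 'a vfield" where
  "fscale f X = (\<lambda>p. tscale (f p) (X p))"

definition vfields :: "('a, 'e::euclidean_space) chart set \<Rightarrow> 'a vfield set" where
  "vfields A = {X. (\<forall>p. X p \<in> tangent_space A p) \<and>
                   (\<forall>f\<in>smooth_funs A. (\<lambda>p. X p f) \<in> smooth_funs A)}"

definition dirderiv :: "'a vfield \<Rightarrow> ('a \<Rightarrow> real) \<Rightarrow> 'a \<Rightarrow> real" where
  "dirderiv X f = (\<lambda>p. X p f)"

definition cdirderiv :: "'a vfield \<Rightarrow> ('a \<Rightarrow> complex) \<Rightarrow> 'a \<Rightarrow> complex" where
  "cdirderiv X f = (\<lambda>p. Complex (dirderiv X (\<lambda>q. Re (f q)) p) (dirderiv X (\<lambda>q. Im (f q)) p))"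

definition lie_bracket :: "'a vfield \<Rightarrow> 'a vfield \<Rightarrow> 'a vfield" where
  "lie_bracket X Y = (\<lambda>p f. dirderiv X (dirderiv Y f) p - dirderiv Y (dirderiv X f) p)"

section \<open>Almost Hermitian structures\<close>

definition linear_on_tangent ::
  "('a, 'e::euclidean_space) chart set \<Rightarrow> 'a \<Rightarrow> ('a tvec \<Rightarrow> 'b::real_vector) \<Rightarrow> bool" where
  "linear_on_tangent A p L \<longleftrightarrow>
     (\<forall>u\<in>tangent_space A p. \<forall>v\<in>tangent_space A p. L (u + v) = L u + L v) \<and>
     (\<forall>a. \<forall>u\<in>tangent_space A p. L (tscale a u) = a *\<^sub>R L u)"

type_synonym 'a tensor2 = "'a \<Rightarrow> 'a tvec \<Rightarrow> 'a tvec \<Rightarrow> real"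
type_synonym 'a endo = "'a \<Rightarrow> 'a tvec \<Rightarrow> 'a tvec"
type_synonym 'a cform4 = "'a \<Rightarrow> 'a tvec \<Rightarrow> 'a tvec \<Rightarrow> 'a tvec \<Rightarrow> 'a tvec \<Rightarrow> complex"

definition metric_app :: "'a tensor2 \<Rightarrow> 'a vfield \<Rightarrow> 'a vfield \<Rightarrow> 'a \<Rightarrow> real" where
  "metric_app g X Y = (\<lambda>p. g p (X p) (Y p))"

definition endo_app :: "'a endo \<Rightarrow> 'a vfield \<Rightarrow> 'a vfield" where
  "endo_app J X = (\<lambda>p. J p (X p))"

definition form4_app ::
  "'a cform4 \<Rightarrow> 'a vfield \<Rightarrow> 'a vfield \<Rightarrow> 'a vfield \<Rightarrow> 'a vfield \<Rightarrow> 'a \<Rightarrow> complex" where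
  "form4_app \<Psi> X Y Z W = (\<lambda>p. \<Psi> p (X p) (Y p) (Z p) (W p))"

definition riemannian_metric ::
  "('a, 'e::euclidean_space) chart set \<Rightarrow> 'a tensor2 \<Rightarrow> bool" where
  "riemannian_metric A g \<longleftrightarrow>
     (\<forall>p. \<forall>u\<in>tangent_space A p.
        linear_on_tangent A p (g p u) \<and>
        (\<forall>v\<in>tangent_space A p. g p u v = g p v u) \<and>
        (u \<noteq> 0 \<longrightarrow> g p u u > 0)) \<and>
     (\<forall>X\<in>vfields A. \<forall>Y\<in>vfields A. metric_app g X Y \<in> smooth_funs A)"

definition almost_complex ::
  "('a, 'e::euclidean_space) chart set \<Rightarrow> 'a endo \<Rightarrow> bool" where
  "almost_complex A J \<longleftrightarrow>
     (\<forall>p. \<forall>u\<in>tangent_space A p.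
        J p u \<in> tangent_space A p \<and> J p (J p u) = - u \<and>
        (\<forall>v\<in>tangent_space A p. J p (u + v) = J p u + J p v) \<and>
        (\<forall>a. J p (tscale a u) = tscale a (J p u))) \<and>
     (\<forall>X\<in>vfields A. endo_app J X \<in> vfields A)"

definition almost_hermitian ::
  "('a, 'e::euclidean_space) chart set \<Rightarrow> 'a tensor2 \<Rightarrow> 'a endo \<Rightarrow> bool" where
  "almost_hermitian A g J \<longleftrightarrow> riemannian_metric A g \<and> almost_complex A J \<and>
     (\<forall>p. \<forall>u\<in>tangent_space A p. \<forall>v\<in>tangent_space A p. g p (J p u) (J p v) = g p u v)"

text \<open>The Nijenhuis tensor, with its upper index lowered by the metric.\<close>

definition nijenhuis ::
  "'a tensor2 \<Rightarrow> 'a endo \<Rightarrow> 'a vfield \<Rightarrow> 'a vfield \<Rightarrow> 'a vfield \<Rightarrow> 'a \<Rightarrow> real" where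
  "nijenhuis g J X Y Z = metric_app g
     (lie_bracket (endo_app J X) (endo_app J Y) - lie_bracket X Y
      - endo_app J (lie_bracket (endo_app J X) Y) - endo_app J (lie_bracket X (endo_app J Y))) Z"

section \<open>SU(4)-structures\<close>

definition smooth_cform4 ::
  "('a, 'e::euclidean_space) chart set \<Rightarrow> 'a cform4 \<Rightarrow> bool" where
  "smooth_cform4 A \<Psi> \<longleftrightarrow>
     (\<forall>p. \<forall>u\<in>tangent_space A p. \<forall>v\<in>tangent_space A p. \<forall>w\<in>tangent_space A p.
        linear_on_tangent A p (\<Psi> p u v w) \<and>
        (\<forall>z\<in>tangent_space A p.
           \<Psi> p v u w z = - \<Psi> p u v w z \<and>
           \<Psi> p u w v z = - \<Psi> p u v w z \<and>
           \<Psi> p u v z w = - \<Psi> p u v w z)) \<and>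
     (\<forall>X\<in>vfields A. \<forall>Y\<in>vfields A. \<forall>Z\<in>vfields A. \<forall>W\<in>vfields A.
        (\<lambda>p. Re (form4_app \<Psi> X Y Z W p)) \<in> smooth_funs A \<and>
        (\<lambda>p. Im (form4_app \<Psi> X Y Z W p)) \<in> smooth_funs A)"

text \<open>Type (4,0) means complex multilinear with respect to J. By antisymmetry it is enough to
  say so in the first argument.\<close>

definition type_40 ::
  "('a, 'e::euclidean_space) chart set \<Rightarrow> 'a endo \<Rightarrow> 'a cform4 \<Rightarrow> bool" where
  "type_40 A J \<Psi> \<longleftrightarrow>
     (\<forall>p. \<forall>u\<in>tangent_space A p. \<forall>v\<in>tangent_space A p. \<forall>w\<in>tangent_space A p.
        \<forall>z\<in>tangent_space A p. \<Psi> p (J p u) v w z = \<i> * \<Psi> p u v w z)"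

definition orthonormal_frame_at ::
  "('a, 'e::euclidean_space) chart set \<Rightarrow> 'a tensor2 \<Rightarrow> 'a \<Rightarrow> (nat \<Rightarrow> 'a tvec) \<Rightarrow> bool" where
  "orthonormal_frame_at A g p e \<longleftrightarrow>
     (\<forall>i<DIM('e). e i \<in> tangent_space A p) \<and>
     (\<forall>i<DIM('e). \<forall>j<DIM('e). g p (e i) (e j) = (if i = j then 1 else 0))"

text \<open>The squared norm of a 4-form at a point is 1/4! times the sum of the squared moduli of its
  components in any orthonormal frame; it does not depend on the frame.\<close>

definition constant_norm ::
  "('a, 'e::euclidean_space) chart set \<Rightarrow> 'a tensor2 \<Rightarrow> 'a cform4 \<Rightarrow> bool" where
  "constant_norm A g \<Psi> \<longleftrightarrow>
     (\<exists>C. \<forall>p e. orthonormal_frame_at A g p e \<longrightarrow>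
        (\<Sum>i<DIM('e). \<Sum>j<DIM('e). \<Sum>k<DIM('e). \<Sum>l<DIM('e).
           (cmod (\<Psi> p (e i) (e j) (e k) (e l)))\<^sup>2) / fact 4 = C)"

definition su4_form ::
  "('a, real^8) chart set \<Rightarrow> 'a tensor2 \<Rightarrow> 'a endo \<Rightarrow> 'a cform4 \<Rightarrow> bool" where
  "su4_form A g J \<Psi> \<longleftrightarrow> smooth_cform4 A \<Psi> \<and> type_40 A J \<Psi> \<and>
     (\<forall>p. \<exists>u\<in>tangent_space A p. \<exists>v\<in>tangent_space A p. \<exists>w\<in>tangent_space A p.
        \<exists>z\<in>tangent_space A p. \<Psi> p u v w z \<noteq> 0) \<and>
     constant_norm A g \<Psi>"

section \<open>Connections\<close>

type_synonym 'a connection = "'a vfield \<Rightarrow> 'a vfield \<Rightarrow> 'a vfield"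

definition linear_connection ::
  "('a, 'e::euclidean_space) chart set \<Rightarrow> 'a connection \<Rightarrow> bool" where
  "linear_connection A nabla \<longleftrightarrow>
     (\<forall>X\<in>vfields A. \<forall>Y\<in>vfields A.
        nabla X Y \<in> vfields A \<and>
        (\<forall>Z\<in>vfields A. nabla (X + Y) Z = nabla X Z + nabla Y Z \<and>
                       nabla X (Y + Z) = nabla X Y + nabla X Z) \<and>
        (\<forall>f\<in>smooth_funs A.
           nabla (fscale f X) Y = fscale f (nabla X Y) \<and>
           nabla X (fscale f Y) = fscale (dirderiv X f) Y + fscale f (nabla X Y)))"

definition torsion ::
  "'a tensor2 \<Rightarrow> 'a connection \<Rightarrow> 'a vfield \<Rightarrow> 'a vfield \<Rightarrow> 'a vfield \<Rightarrow> 'a \<Rightarrow> real" where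
  "torsion g nabla X Y Z = metric_app g (nabla X Y - nabla Y X - lie_bracket X Y) Z"

definition cov_metric ::
  "'a tensor2 \<Rightarrow> 'a connection \<Rightarrow> 'a vfield \<Rightarrow> 'a vfield \<Rightarrow> 'a vfield \<Rightarrow> 'a \<Rightarrow> real" where
  "cov_metric g nabla X Y Z =
     dirderiv X (metric_app g Y Z) - metric_app g (nabla X Y) Z - metric_app g Y (nabla X Z)"

definition cov_endo ::
  "'a endo \<Rightarrow> 'a connection \<Rightarrow> 'a vfield \<Rightarrow> 'a vfield \<Rightarrow> 'a vfield" where
  "cov_endo J nabla X Y = nabla X (endo_app J Y) - endo_app J (nabla X Y)"

definition cov_form4 ::
  "'a cform4 \<Rightarrow> 'a connection \<Rightarrow> 'a vfield \<Rightarrow> 'a vfield \<Rightarrow> 'a vfield \<Rightarrow> 'a vfield \<Rightarrow> 'a vfield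
     \<Rightarrow> 'a \<Rightarrow> complex" where
  "cov_form4 \<Psi> nabla X Y1 Y2 Y3 Y4 =
     cdirderiv X (form4_app \<Psi> Y1 Y2 Y3 Y4)
     - form4_app \<Psi> (nabla X Y1) Y2 Y3 Y4 - form4_app \<Psi> Y1 (nabla X Y2) Y3 Y4
     - form4_app \<Psi> Y1 Y2 (nabla X Y3) Y4 - form4_app \<Psi> Y1 Y2 Y3 (nabla X Y4)"

text \<open>Derived (0,3)-tensors such as the torsion and the Nijenhuis tensor are represented by their
  action on vector fields.\<close>

type_synonym 'a tensor3 = "'a vfield \<Rightarrow> 'a vfield \<Rightarrow> 'a vfield \<Rightarrow> 'a \<Rightarrow> real"

definition cov_tensor3 ::
  "'a tensor3 \<Rightarrow> 'a connection \<Rightarrow> 'a vfield \<Rightarrow> 'a vfield \<Rightarrow> 'a vfield \<Rightarrow> 'a vfield \<Rightarrow> 'a \<Rightarrow> real"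
  where
  "cov_tensor3 t nabla X Y1 Y2 Y3 =
     dirderiv X (t Y1 Y2 Y3)
     - t (nabla X Y1) Y2 Y3 - t Y1 (nabla X Y2) Y3 - t Y1 Y2 (nabla X Y3)"

definition ext_deriv3 ::
  "'a tensor3 \<Rightarrow> 'a vfield \<Rightarrow> 'a vfield \<Rightarrow> 'a vfield \<Rightarrow> 'a vfield \<Rightarrow> 'a \<Rightarrow> real" where
  "ext_deriv3 t X Y Z W =
     dirderiv X (t Y Z W) - dirderiv Y (t X Z W) + dirderiv Z (t X Y W) - dirderiv W (t X Y Z)
     - t (lie_bracket X Y) Z W + t (lie_bracket X Z) Y W - t (lie_bracket X W) Y Z
     - t (lie_bracket Y Z) X W + t (lie_bracket Y W) X Z - t (lie_bracket Z W) X Y"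

definition totally_skew3 :: "('a, 'e::euclidean_space) chart set \<Rightarrow> 'a tensor3 \<Rightarrow> bool" where
  "totally_skew3 A t \<longleftrightarrow>
     (\<forall>X\<in>vfields A. \<forall>Y\<in>vfields A. \<forall>Z\<in>vfields A.
        t Y X Z = - t X Y Z \<and> t X Z Y = - t X Y Z)"

definition closed3 :: "('a, 'e::euclidean_space) chart set \<Rightarrow> 'a tensor3 \<Rightarrow> bool" where
  "closed3 A t \<longleftrightarrow>
     (\<forall>X\<in>vfields A. \<forall>Y\<in>vfields A. \<forall>Z\<in>vfields A. \<forall>W\<in>vfields A. ext_deriv3 t X Y Z W = 0)"

definition parallel3 ::
  "('a, 'e::euclidean_space) chart set \<Rightarrow> 'a connection \<Rightarrow> 'a tensor3 \<Rightarrow> bool" where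
  "parallel3 A nabla t \<longleftrightarrow>
     (\<forall>X\<in>vfields A. \<forall>Y1\<in>vfields A. \<forall>Y2\<in>vfields A. \<forall>Y3\<in>vfields A.
        cov_tensor3 t nabla X Y1 Y2 Y3 = 0)"

definition torsion_connection ::
  "('a, real^8) chart set \<Rightarrow> 'a tensor2 \<Rightarrow> 'a endo \<Rightarrow> 'a cform4 \<Rightarrow> 'a connection \<Rightarrow> bool" where
  "torsion_connection A g J \<Psi> nabla \<longleftrightarrow> linear_connection A nabla \<and>
     (\<forall>X\<in>vfields A. \<forall>Y\<in>vfields A. \<forall>Z\<in>vfields A. cov_metric g nabla X Y Z = 0) \<and>
     (\<forall>X\<in>vfields A. \<forall>Y\<in>vfields A. cov_endo J nabla X Y = 0) \<and>
     (\<forall>X\<in>vfields A. \<forall>Y1\<in>vfields A. \<forall>Y2\<in>vfields A. \<forall>Y3\<in>vfields A. \<forall>Y4\<in>vfields A.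
        cov_form4 \<Psi> nabla X Y1 Y2 Y3 Y4 = 0) \<and>
     totally_skew3 A (torsion g nabla)"

end

theory Submission
  imports Defs
begin

text \<open>Let \<open>T\<close> be the torsion and \<open>R\<close> the curvature of a metric connection with skew torsion and
  \<open>dT = 0\<close>. Combining four instances of the first Bianchi identity gives
  \<open>(\<nabla>\<^sub>V T)(X,Y,Z) = R(V,X,Y,Z) + R(V,Y,Z,X) + R(V,Z,X,Y)\<close>. As \<open>\<nabla>J = 0\<close>, the Nijenhuis tensor is
  \<open>N(X,Y,Z) = T(X,Y,Z) - T(JX,JY,Z) - T(JX,Y,JZ) - T(X,JY,JZ)\<close>, that is, four times the
  (3,0)+(0,3) part of \<open>T\<close>. The last two arguments of \<open>R\<close> are of type (1,1), so the cyclic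
  sum has no such part and \<open>\<nabla>N = 0\<close>.\<close>

section \<open>Smooth functions and vector fields\<close>

text \<open>As \<open>S\<close> is open, functions that agree on \<open>S\<close> agree near each of
  its points and so have the same derivatives there. The rules below can thus use derivative
  formulas that hold on \<open>S\<close> only.\<close>

lemma Ck_on_cong:
  assumes "open S" "\<And>x. x \<in> S \<Longrightarrow> f x = h x"
  shows "Ck_on k S f \<longleftrightarrow> Ck_on k S h"
  using assms(2)
proof (induction k arbitrary: f h)
  case 0
  then show ?case by (simp cong: continuous_on_cong)
next
  case (Suc k)
  have der: "(f has_derivative D) (at x) \<longleftrightarrow> (h has_derivative D) (at x)" if "x \<in> S" for x D
    using that Suc.prems assms(1)
    by (metis has_derivative_transform_within_open)
  then have "f differentiable (at x) \<longleftrightarrow> h differentiable (at x)" if "x \<in> S" for x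
    using that by (auto simp: differentiable_def)
  moreover have "frechet_derivative f (at x) = frechet_derivative h (at x)" if "x \<in> S" for x
    using der[OF that] by (simp add: frechet_derivative_def)
  then have "Ck_on k S (\<lambda>x. frechet_derivative f (at x) v) \<longleftrightarrow>
      Ck_on k S (\<lambda>x. frechet_derivative h (at x) v)" for v
    by (intro Suc.IH) simp
  ultimately show ?case by auto
qed

lemma Ck_on_SucD:
  assumes "Ck_on (Suc k) S f"
  shows "Ck_on k S f"
  using assms
proof (induction k arbitrary: f)
  case 0
  then show ?case
    by (auto intro!: continuous_at_imp_continuous_on differentiable_imp_continuous_within)
next
  case (Suc k)
  then show ?case by (metis Ck_on.simps(2))
qed

lemma Ck_on_const: "Ck_on k S (\<lambda>x. c)"
  by (induction k arbitrary: c) auto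

lemma Ck_on_add:
  assumes "open S" "Ck_on k S f" "Ck_on k S h"
  shows "Ck_on k S (\<lambda>x. f x + h x)"
  using assms(2,3)
proof (induction k arbitrary: f h)
  case 0
  then show ?case by (auto intro: continuous_intros)
next
  case (Suc k)
  have "frechet_derivative (\<lambda>x. f x + h x) (at x) v =
      frechet_derivative f (at x) v + frechet_derivative h (at x) v" if "x \<in> S" for x v
    using Suc.prems that
    by (auto intro!: fun_cong[OF frechet_derivative_at[symmetric]] has_derivative_add
        simp: frechet_derivative_works)
  then have "Ck_on k S (\<lambda>x. frechet_derivative (\<lambda>x. f x + h x) (at x) v)" for v
    using Suc.IH[of "\<lambda>x. frechet_derivative f (at x) v" "\<lambda>x. frechet_derivative h (at x) v"] Suc.prems
    by (subst Ck_on_cong[OF assms(1)]) auto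
  then show ?case using Suc.prems by auto
qed

lemma Ck_on_mult:
  fixes f h :: "'e::euclidean_space \<Rightarrow> 'f::real_normed_algebra"
  assumes "open S" "Ck_on k S f" "Ck_on k S h"
  shows "Ck_on k S (\<lambda>x. f x * h x)"
  using assms(2,3)
proof (induction k arbitrary: f h)
  case 0
  then show ?case by (auto intro: continuous_intros)
next
  case (Suc k)
  have "frechet_derivative (\<lambda>x. f x * h x) (at x) v =
      f x * frechet_derivative h (at x) v + frechet_derivative f (at x) v * h x" if "x \<in> S" for x v
    using Suc.prems that
    by (auto intro!: fun_cong[OF frechet_derivative_at[symmetric]] has_derivative_mult
        simp: frechet_derivative_works)
  \<comment> \<open>The product rule leaves one factor undifferentiated in each term, and the
    induction hypothesis wants that factor at order \<open>k\<close>.\<close>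
  moreover have "Ck_on k S f" "Ck_on k S h"
    by (rule Ck_on_SucD, rule Suc.prems)+
  then have "Ck_on k S (\<lambda>x. f x * frechet_derivative h (at x) v + frechet_derivative f (at x) v * h x)" for v
    using Suc by (intro Ck_on_add[OF assms(1)] Suc.IH) auto
  ultimately have "Ck_on k S (\<lambda>x. frechet_derivative (\<lambda>x. f x * h x) (at x) v)" for v
    by (subst Ck_on_cong[OF assms(1)])
  then show ?case using Suc.prems by auto
qed

lemma open_chart_image: "smooth_atlas A \<Longrightarrow> c \<in> A \<Longrightarrow> open (chart_image c)"
  by (simp add: smooth_atlas_def is_chart_def)

lemma smooth_funs_add:
  assumes "smooth_atlas A" "f \<in> smooth_funs A" "h \<in> smooth_funs A"
  shows "f + h \<in> smooth_funs A"
  using assms by (simp add: smooth_funs_def smooth_on_def o_def Ck_on_add open_chart_image)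

lemma smooth_funs_mult:
  assumes "smooth_atlas A" "f \<in> smooth_funs A" "h \<in> smooth_funs A"
  shows "f * h \<in> smooth_funs A"
  using assms by (simp add: smooth_funs_def smooth_on_def o_def Ck_on_mult open_chart_image)

lemma smooth_funs_diff:
  assumes "smooth_atlas A" "f \<in> smooth_funs A" "h \<in> smooth_funs A"
  shows "f - h \<in> smooth_funs A"
proof -
  have "(\<lambda>_. -1) \<in> smooth_funs A"
    by (simp add: smooth_funs_def smooth_on_def o_def Ck_on_const)
  moreover have "f - h = f + (\<lambda>_. -1) * h"
    by (simp add: fun_eq_iff)
  ultimately show ?thesis
    by (metis assms smooth_funs_add smooth_funs_mult)
qed

section \<open>Tangent vectors as derivations, vector fields and their brackets\<close>

lemma tangent_space_add:
  "v \<in> tangent_space A p \<Longrightarrow> f \<in> smooth_funs A \<Longrightarrow> h \<in> smooth_funs A \<Longrightarrow> v (f + h) = v f + v h"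
  by (simp add: tangent_space_def)

lemma tangent_space_scale:
  "v \<in> tangent_space A p \<Longrightarrow> f \<in> smooth_funs A \<Longrightarrow> v (\<lambda>q. a * f q) = a * v f"
  by (simp add: tangent_space_def)

lemma tangent_space_mult:
  "v \<in> tangent_space A p \<Longrightarrow> f \<in> smooth_funs A \<Longrightarrow> h \<in> smooth_funs A \<Longrightarrow>
    v (f * h) = f p * v h + h p * v f"
  by (simp add: tangent_space_def)

lemma tangent_space_nonsmooth: "v \<in> tangent_space A p \<Longrightarrow> f \<notin> smooth_funs A \<Longrightarrow> v f = 0"
  by (simp add: tangent_space_def)

lemma tangent_space_zero:
  assumes "v \<in> tangent_space A p"
  shows "v (\<lambda>_. 0) = 0"
  \<comment> \<open>Homogeneity with factor 0 settles the case that the zero function is smooth, the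
    default value on non-smooth arguments the other one.\<close>
  using tangent_space_scale[OF assms, of "\<lambda>_. 0" 0] tangent_space_nonsmooth[OF assms] by force

lemma tangent_space_diff:
  assumes "smooth_atlas A" "v \<in> tangent_space A p" "f \<in> smooth_funs A" "h \<in> smooth_funs A"
  shows "v (f - h) = v f - v h"
  using tangent_space_add[OF assms(2) smooth_funs_diff[OF assms(1,3,4)] assms(4)] by simp

lemma minus_in_tangent_space:
  "u \<in> tangent_space A p \<Longrightarrow> v \<in> tangent_space A p \<Longrightarrow> u - v \<in> tangent_space A p"
  by (simp add: tangent_space_def algebra_simps)

lemma vfields_tangent: "X \<in> vfields A \<Longrightarrow> X p \<in> tangent_space A p"
  by (simp add: vfields_def)

lemma dirderiv_smooth: "X \<in> vfields A \<Longrightarrow> f \<in> smooth_funs A \<Longrightarrow> dirderiv X f \<in> smooth_funs A"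
  by (simp add: vfields_def dirderiv_def)

lemma dirderiv_add:
  "X \<in> vfields A \<Longrightarrow> f \<in> smooth_funs A \<Longrightarrow> h \<in> smooth_funs A \<Longrightarrow>
    dirderiv X (f + h) = dirderiv X f + dirderiv X h"
  by (auto simp: dirderiv_def fun_eq_iff tangent_space_add[OF vfields_tangent])

lemma dirderiv_diff:
  "smooth_atlas A \<Longrightarrow> X \<in> vfields A \<Longrightarrow> f \<in> smooth_funs A \<Longrightarrow> h \<in> smooth_funs A \<Longrightarrow>
    dirderiv X (f - h) = dirderiv X f - dirderiv X h"
  by (auto simp: dirderiv_def fun_eq_iff tangent_space_diff[OF _ vfields_tangent])

lemma dirderiv_scale:
  "X \<in> vfields A \<Longrightarrow> f \<in> smooth_funs A \<Longrightarrow> dirderiv X (\<lambda>q. a * f q) = (\<lambda>q. a * dirderiv X f q)"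
  by (auto simp: dirderiv_def fun_eq_iff tangent_space_scale[OF vfields_tangent])

lemma dirderiv_mult:
  "X \<in> vfields A \<Longrightarrow> f \<in> smooth_funs A \<Longrightarrow> h \<in> smooth_funs A \<Longrightarrow>
    dirderiv X (f * h) = f * dirderiv X h + h * dirderiv X f"
  by (auto simp: dirderiv_def fun_eq_iff tangent_space_mult[OF vfields_tangent])

lemma dirderiv_nonsmooth: "X \<in> vfields A \<Longrightarrow> f \<notin> smooth_funs A \<Longrightarrow> dirderiv X f = (\<lambda>_. 0)"
  by (auto simp: dirderiv_def fun_eq_iff tangent_space_nonsmooth[OF vfields_tangent])

lemma dirderiv_zero: "X \<in> vfields A \<Longrightarrow> dirderiv X (\<lambda>_. 0) = (\<lambda>_. 0)"
  by (auto simp: dirderiv_def fun_eq_iff tangent_space_zero[OF vfields_tangent])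

lemma dirderiv_lie_bracket:
  "dirderiv (lie_bracket X Y) f = dirderiv X (dirderiv Y f) - dirderiv Y (dirderiv X f)"
  by (simp add: dirderiv_def lie_bracket_def fun_eq_iff)

lemma dirderiv_minus_field: "dirderiv (X - Y) f = dirderiv X f - dirderiv Y f"
  by (simp add: dirderiv_def fun_eq_iff)

lemma vfields_diff:
  assumes "smooth_atlas A" "X \<in> vfields A" "Y \<in> vfields A"
  shows "X - Y \<in> vfields A"
proof -
  have "X p - Y p \<in> tangent_space A p" for p
    using assms by (intro minus_in_tangent_space vfields_tangent)
  moreover have "dirderiv (X - Y) f \<in> smooth_funs A" if "f \<in> smooth_funs A" for f
    using that assms by (simp add: dirderiv_minus_field smooth_funs_diff dirderiv_smooth)
  ultimately show ?thesis
    by (simp add: vfields_def dirderiv_def)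
qed

lemma vfields_lie_bracket:
  assumes A: "smooth_atlas A" and X: "X \<in> vfields A" and Y: "Y \<in> vfields A"
  shows "lie_bracket X Y \<in> vfields A"
proof -
  note sm = dirderiv_smooth[OF X] dirderiv_smooth[OF Y]
  let ?L = "dirderiv (lie_bracket X Y)"
  have "?L (f + h) = ?L f + ?L h" if "f \<in> smooth_funs A" "h \<in> smooth_funs A" for f h
    using that by (simp add: dirderiv_lie_bracket dirderiv_add[OF X] dirderiv_add[OF Y] sm)
  moreover have "?L (\<lambda>q. a * f q) = (\<lambda>q. a * ?L f q)" if "f \<in> smooth_funs A" for f a
    using that by (simp add: dirderiv_lie_bracket dirderiv_scale[OF X] dirderiv_scale[OF Y] sm
        fun_eq_iff right_diff_distrib)
  \<comment> \<open>The mixed products of a derivative along \<open>X\<close> and one along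
    \<open>Y\<close> occur in both compositions and cancel; only the second-order terms
    remain.\<close>
  moreover have "?L (f * h) = f * ?L h + h * ?L f" if "f \<in> smooth_funs A" "h \<in> smooth_funs A" for f h
    using that by (simp add: dirderiv_lie_bracket dirderiv_mult[OF X] dirderiv_mult[OF Y]
        dirderiv_add[OF X] dirderiv_add[OF Y] sm smooth_funs_mult[OF A] algebra_simps)
  \<comment> \<open>For non-smooth \<open>f\<close> the inner derivative is the zero function, which
    every tangent vector kills.\<close>
  moreover have "?L f = (\<lambda>_. 0)" if "f \<notin> smooth_funs A" for f
    using that by (simp add: dirderiv_lie_bracket dirderiv_nonsmooth[OF X] dirderiv_nonsmooth[OF Y]
        dirderiv_zero[OF X] dirderiv_zero[OF Y] fun_eq_iff)
  ultimately have "lie_bracket X Y p \<in> tangent_space A p" for p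
    by (simp add: tangent_space_def dirderiv_def fun_eq_iff)
  moreover have "?L f \<in> smooth_funs A" if "f \<in> smooth_funs A" for f
    using that by (simp add: dirderiv_lie_bracket smooth_funs_diff[OF A] sm)
  ultimately show ?thesis
    by (simp add: vfields_def dirderiv_def)
qed

lemma lie_bracket_skew: "lie_bracket Y X = - lie_bracket X Y"
  by (simp add: lie_bracket_def fun_eq_iff)

text \<open>On smooth functions the twelve threefold derivatives cancel in pairs. On all others each
  double bracket vanishes by convention, being itself a vector field, so the identity holds as an
  equality of HOL functions.\<close>

lemma lie_bracket_jacobi:
  assumes A: "smooth_atlas A" and X: "X \<in> vfields A" and Y: "Y \<in> vfields A" and Z: "Z \<in> vfields A"
  shows "lie_bracket X (lie_bracket Y Z) + lie_bracket Y (lie_bracket Z X)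
    + lie_bracket Z (lie_bracket X Y) = 0"
proof -
  note fields = X Y Z
  have "dirderiv (lie_bracket X (lie_bracket Y Z)) f p + dirderiv (lie_bracket Y (lie_bracket Z X)) f p
    + dirderiv (lie_bracket Z (lie_bracket X Y)) f p = 0" for f p
  proof (cases "f \<in> smooth_funs A")
    case True
    then show ?thesis
      by (simp add: dirderiv_lie_bracket fields dirderiv_diff[OF A] dirderiv_smooth)
  next
    case False
    then show ?thesis
      using fields vfields_lie_bracket[OF A] by (simp add: dirderiv_nonsmooth[where A=A])
  qed
  then show ?thesis
    by (simp add: dirderiv_def fun_eq_iff)
qed

section \<open>Metric connections with closed skew torsion\<close>

text \<open>\<open>E\<close> is a Lie algebra of fields, acting on the functions \<open>C\<close> by \<open>D\<close>.\<close>

locale metric_connection =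
  fixes E :: "'v::ab_group_add set" and C :: "('a \<Rightarrow> real) set"
    and D :: "'v \<Rightarrow> ('a \<Rightarrow> real) \<Rightarrow> 'a \<Rightarrow> real"
    and br :: "'v \<Rightarrow> 'v \<Rightarrow> 'v" and g :: "'v \<Rightarrow> 'v \<Rightarrow> 'a \<Rightarrow> real"
    and nabla :: "'v \<Rightarrow> 'v \<Rightarrow> 'v"
  assumes E_diff: "X \<in> E \<Longrightarrow> Y \<in> E \<Longrightarrow> X - Y \<in> E"
    and E_br: "X \<in> E \<Longrightarrow> Y \<in> E \<Longrightarrow> br X Y \<in> E"
    and E_nabla: "X \<in> E \<Longrightarrow> Y \<in> E \<Longrightarrow> nabla X Y \<in> E"
    and C_g: "X \<in> E \<Longrightarrow> Y \<in> E \<Longrightarrow> g X Y \<in> C"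
    and C_diff: "f \<in> C \<Longrightarrow> h \<in> C \<Longrightarrow> f - h \<in> C"
    and D_diff: "X \<in> E \<Longrightarrow> f \<in> C \<Longrightarrow> h \<in> C \<Longrightarrow> D X (f - h) = D X f - D X h"
    and D_add: "X \<in> E \<Longrightarrow> f \<in> C \<Longrightarrow> h \<in> C \<Longrightarrow> D X (f + h) = D X f + D X h"
    and D_br: "D (br X Y) f = D X (D Y f) - D Y (D X f)"
    and br_skew: "br Y X = - br X Y"
    and jacobi: "X \<in> E \<Longrightarrow> Y \<in> E \<Longrightarrow> Z \<in> E \<Longrightarrow> br X (br Y Z) + br Y (br Z X) + br Z (br X Y) = 0"
    and g_sym: "X \<in> E \<Longrightarrow> Y \<in> E \<Longrightarrow> g X Y = g Y X"
    and g_diff: "X \<in> E \<Longrightarrow> Y \<in> E \<Longrightarrow> Z \<in> E \<Longrightarrow> g (X - Y) Z = g X Z - g Y Z"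
    and nabla_diff_left: "X \<in> E \<Longrightarrow> Y \<in> E \<Longrightarrow> Z \<in> E \<Longrightarrow> nabla (X - Y) Z = nabla X Z - nabla Y Z"
    and nabla_diff: "X \<in> E \<Longrightarrow> Y \<in> E \<Longrightarrow> Z \<in> E \<Longrightarrow> nabla X (Y - Z) = nabla X Y - nabla X Z"
    and nabla_g: "X \<in> E \<Longrightarrow> Y \<in> E \<Longrightarrow> Z \<in> E \<Longrightarrow> D X (g Y Z) = g (nabla X Y) Z + g Y (nabla X Z)"
begin

definition tor :: "'v \<Rightarrow> 'v \<Rightarrow> 'v" where
  "tor X Y = nabla X Y - nabla Y X - br X Y"

definition T :: "'v \<Rightarrow> 'v \<Rightarrow> 'v \<Rightarrow> 'a \<Rightarrow> real" where
  "T X Y Z = g (tor X Y) Z"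

end

locale closed_skew_torsion = metric_connection +
  assumes T_skew12: "X \<in> E \<Longrightarrow> Y \<in> E \<Longrightarrow> Z \<in> E \<Longrightarrow> T Y X Z = - T X Y Z"
    and T_skew23: "X \<in> E \<Longrightarrow> Y \<in> E \<Longrightarrow> Z \<in> E \<Longrightarrow> T X Z Y = - T X Y Z"
    and T_closed: "X \<in> E \<Longrightarrow> Y \<in> E \<Longrightarrow> Z \<in> E \<Longrightarrow> W \<in> E \<Longrightarrow>
      D X (T Y Z W) - D Y (T X Z W) + D Z (T X Y W) - D W (T X Y Z)
      - T (br X Y) Z W + T (br X Z) Y W - T (br X W) Y Z
      - T (br Y Z) X W + T (br Y W) X Z - T (br Z W) X Y = 0"
begin

text \<open>\<open>g (R X Y Z) W\<close> is what is usually written R(X,Y,Z,W). In this locale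
  \<open>'a\<close> is the type of the fields and \<open>'b\<close> that of the points, unlike in
  \<open>metric_connection\<close>.\<close>

definition R :: "'a \<Rightarrow> 'a \<Rightarrow> 'a \<Rightarrow> 'a" where
  "R X Y Z = nabla X (nabla Y Z) - nabla Y (nabla X Z) - nabla (br X Y) Z"

text \<open>This is (\<nabla>_V T)(X,Y,Z); the direction of differentiation comes first.\<close>

definition DT :: "'a \<Rightarrow> 'a \<Rightarrow> 'a \<Rightarrow> 'a \<Rightarrow> 'b \<Rightarrow> real" where
  "DT V X Y Z = D V (T X Y Z) - T (nabla V X) Y Z - T X (nabla V Y) Z - T X Y (nabla V Z)"

section \<open>Additive rules derived from the axioms on differences\<close>

lemma E_zero: "X \<in> E \<Longrightarrow> 0 \<in> E"
  using E_diff[of X X] by simp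

lemma E_uminus: "X \<in> E \<Longrightarrow> - X \<in> E"
  using E_diff[OF E_zero] by fastforce

lemma E_add: "X \<in> E \<Longrightarrow> Y \<in> E \<Longrightarrow> X + Y \<in> E"
  using E_diff[OF _ E_uminus] by fastforce

lemma E_tor: "X \<in> E \<Longrightarrow> Y \<in> E \<Longrightarrow> tor X Y \<in> E"
  by (simp add: tor_def E_diff E_nabla E_br)

lemma E_R: "X \<in> E \<Longrightarrow> Y \<in> E \<Longrightarrow> Z \<in> E \<Longrightarrow> R X Y Z \<in> E"
  by (simp add: R_def E_diff E_nabla E_br)

lemmas E_closed = E_diff E_uminus E_add E_br E_nabla E_tor E_R

lemma g_zero: "Z \<in> E \<Longrightarrow> g 0 Z = 0"
  using g_diff[of Z Z Z] by simp

lemma g_uminus: "X \<in> E \<Longrightarrow> Z \<in> E \<Longrightarrow> g (- X) Z = - g X Z"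
  using g_diff[of 0 X Z] by (simp add: E_zero g_zero)

lemma g_add: "X \<in> E \<Longrightarrow> Y \<in> E \<Longrightarrow> Z \<in> E \<Longrightarrow> g (X + Y) Z = g X Z + g Y Z"
  using g_diff[of X "- Y" Z] by (simp add: E_uminus g_uminus)

lemma g_uminus_right: "X \<in> E \<Longrightarrow> Z \<in> E \<Longrightarrow> g X (- Z) = - g X Z"
  using g_uminus[of Z X] by (simp add: g_sym[of X] E_uminus)

lemma nabla_zero_left: "X \<in> E \<Longrightarrow> nabla 0 X = 0"
  using nabla_diff_left[of X X X] by simp

lemma nabla_uminus_left: "X \<in> E \<Longrightarrow> Y \<in> E \<Longrightarrow> nabla (- X) Y = - nabla X Y"
  using nabla_diff_left[of 0 X Y] by (simp add: E_zero nabla_zero_left)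

lemma C_T: "X \<in> E \<Longrightarrow> Y \<in> E \<Longrightarrow> Z \<in> E \<Longrightarrow> T X Y Z \<in> C"
  by (simp add: T_def C_g E_closed)

lemma T_diff3: "X \<in> E \<Longrightarrow> Y \<in> E \<Longrightarrow> Z \<in> E \<Longrightarrow> W \<in> E \<Longrightarrow> T X Y (Z - W) = T X Y Z - T X Y W"
  by (simp add: T_def g_diff g_sym[of "tor X Y"] E_closed)

lemma T_cyclic: "X \<in> E \<Longrightarrow> Y \<in> E \<Longrightarrow> Z \<in> E \<Longrightarrow> T X Y Z = T Y Z X"
  using T_skew12[of X Y Z] T_skew23[of Y X Z] by simp

text \<open>The axioms do not provide additivity of \<open>br\<close>, hence none of
  \<open>tor\<close>. Skew symmetry helps: a cyclic rotation moves the argument to the last slot,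
  where additivity is that of \<open>g\<close>.\<close>

lemma T_diff1: "X \<in> E \<Longrightarrow> Y \<in> E \<Longrightarrow> Z \<in> E \<Longrightarrow> W \<in> E \<Longrightarrow> T (X - W) Y Z = T X Y Z - T W Y Z"
  by (simp add: T_cyclic[of _ Y Z] T_diff3 E_closed)

section \<open>Curvature symmetries and the first Bianchi identity for fields\<close>

lemma R_skew12: "X \<in> E \<Longrightarrow> Y \<in> E \<Longrightarrow> Z \<in> E \<Longrightarrow> R Y X Z = - R X Y Z"
  by (simp add: R_def br_skew[of Y X] nabla_uminus_left E_closed)

text \<open>Metric compatibility applied twice expands both sides of \<open>D_br\<close> for the
  function \<open>g Z W\<close>; the products of two first covariant derivatives cancel.\<close>

lemma R_skew34:
  assumes "X \<in> E" "Y \<in> E" "Z \<in> E" "W \<in> E"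
  shows "g (R X Y W) Z = - g (R X Y Z) W"
proof -
  have "D (br X Y) (g Z W) = D X (D Y (g Z W)) - D Y (D X (g Z W))"
    by (rule D_br)
  then have "g (nabla (br X Y) Z) W + g Z (nabla (br X Y) W) =
      g (nabla X (nabla Y Z)) W + g Z (nabla X (nabla Y W))
      - g (nabla Y (nabla X Z)) W - g Z (nabla Y (nabla X W))"
    using assms by (simp add: nabla_g D_add C_g E_closed)
  then show ?thesis
    using assms by (simp add: R_def g_diff g_sym[of Z] E_closed) (simp add: algebra_simps)
qed

text \<open>The nine terms of the cyclic sum are regrouped into triples as in the auxiliary identity
  below. Each triple yields two torsion terms and a double bracket, and the double brackets add up
  to zero by the Jacobi identity.\<close>

lemma bianchi_field:
  assumes "X \<in> E" "Y \<in> E" "Z \<in> E"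
  shows "R X Y Z + R Y Z X + R Z X Y =
    nabla X (tor Y Z) + nabla Y (tor Z X) + nabla Z (tor X Y)
    + tor X (br Y Z) + tor Y (br Z X) + tor Z (br X Y)"
proof -
  have "nabla U (nabla V W) - nabla U (nabla W V) - nabla (br V W) U =
      nabla U (tor V W) + tor U (br V W) + br U (br V W)" if "U \<in> E" "V \<in> E" "W \<in> E" for U V W
    using that by (simp add: tor_def nabla_diff E_closed)
  note this[of X Y Z] this[of Y Z X] this[of Z X Y] jacobi[of X Y Z]
  then show ?thesis
    using assms unfolding R_def by (simp add: algebra_simps)
qed

section \<open>Closedness of the torsion in terms of the connection\<close>

lemma T_br:
  assumes "X \<in> E" "Y \<in> E" "Z \<in> E" "W \<in> E"
  shows "T (br X Y) Z W = T (nabla X Y) Z W - T (nabla Y X) Z W - T (tor X Y) Z W"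
proof -
  have "br X Y = nabla X Y - nabla Y X - tor X Y"
    by (simp add: tor_def)
  then show ?thesis
    using assms by (simp add: T_diff1 E_closed)
qed

text \<open>Both sides are the inner product of \<open>tor X Y\<close> and
  \<open>tor Z W\<close>.\<close>

lemma T_tor_sym:
  assumes "X \<in> E" "Y \<in> E" "Z \<in> E" "W \<in> E"
  shows "T (tor Z W) X Y = T (tor X Y) Z W"
proof -
  have "T (tor Z W) X Y = T X Y (tor Z W)"
    using assms by (simp add: T_cyclic E_closed)
  also have "\<dots> = T Z W (tor X Y)"
    using assms by (simp add: T_def g_sym E_closed)
  also have "\<dots> = T (tor X Y) Z W"
    using assms by (simp add: T_cyclic[of "tor X Y"] E_closed)
  finally show ?thesis .
qed

lemma tor_skew: "tor Y X = - tor X Y"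
  by (simp add: tor_def br_skew[of Y X])

lemma T_tor_skew:
  "X \<in> E \<Longrightarrow> Y \<in> E \<Longrightarrow> Z \<in> E \<Longrightarrow> W \<in> E \<Longrightarrow> T (tor Y X) Z W = - T (tor X Y) Z W"
  \<comment> \<open>The second instance says that \<open>T 0 Z W\<close> vanishes, so the first one
    pulls out the sign of \<open>- tor X Y\<close>.\<close>
  using T_diff1[of 0 Z W "tor X Y"] T_diff1[of 0 Z W 0] E_zero[of X]
  by (simp add: tor_skew[of Y X] E_closed)

lemma D_uminus: "X \<in> E \<Longrightarrow> f \<in> C \<Longrightarrow> D X (- f) = - D X f"
  using D_diff[of X "f - f" f] D_diff[of X f f] C_diff[of f f] by simp

lemma D_T_skew12: "V \<in> E \<Longrightarrow> X \<in> E \<Longrightarrow> Y \<in> E \<Longrightarrow> Z \<in> E \<Longrightarrow> D V (T Y X Z) = - D V (T X Y Z)"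
  by (simp add: T_skew12[of X Y Z] D_uminus C_T)

text \<open>With all covariant derivatives in the first slot, the terms can be matched with those
  that \<open>T_br\<close> produces.\<close>

lemma DT_nabla_first:
  assumes "X \<in> E" "Y \<in> E" "Z \<in> E" "V \<in> E"
  shows "DT V X Y Z = D V (T X Y Z) - T (nabla V X) Y Z + T (nabla V Y) X Z - T (nabla V Z) X Y"
  using assms by (simp add: DT_def T_skew12[of "nabla V Y" X Z] T_cyclic[of "nabla V Z" X Y] E_closed)

text \<open>Writing the brackets in \<open>T_closed\<close> through \<open>nabla\<close> and
  \<open>tor\<close> turns the first-order part into derivatives of \<open>T\<close>. It leaves six
  quadratic torsion terms, which coincide in pairs by \<open>T_tor_sym\<close>; hence the factor
  2.\<close>

lemma closed_DT:
  assumes [simp]: "X \<in> E" "Y \<in> E" "Z \<in> E" "W \<in> E"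
  shows "DT X Y Z W p + DT Y Z X W p + DT Z X Y W p - DT W X Y Z p
    + 2 * (T (tor X Y) Z W p + T (tor Y Z) X W p + T (tor Z X) Y W p) = 0"
proof -
  have "T (tor X W) Y Z = T (tor Y Z) X W" "T (tor Y W) X Z = T (tor X Z) Y W"
      "T (tor Z W) X Y = T (tor X Y) Z W" "T (tor Z X) Y W = - T (tor X Z) Y W"
    by (rule T_tor_sym T_tor_skew; simp)+
  moreover have "D Y (T Z X W) = - D Y (T X Z W)" "T (nabla Y W) Z X = - T (nabla Y W) X Z"
    by (rule D_T_skew12 T_skew23; simp add: E_closed)+
  ultimately show ?thesis
    using fun_cong[OF T_closed[of X Y Z W], of p]
    by (simp add: T_br DT_nabla_first)
qed

text \<open>Pairing the identity for fields with \<open>W\<close> gives the derivatives of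
  \<open>T\<close> along \<open>X\<close>, \<open>Y\<close> and \<open>Z\<close> plus one copy of
  the quadratic terms. By \<open>closed_DT\<close> these derivatives equal
  \<open>DT W X Y Z p\<close> minus two copies.\<close>

lemma bianchi:
  assumes [simp]: "X \<in> E" "Y \<in> E" "Z \<in> E" "W \<in> E"
  shows "g (R X Y Z) W p + g (R Y Z X) W p + g (R Z X Y) W p =
    DT W X Y Z p - (T (tor X Y) Z W p + T (tor Y Z) X W p + T (tor Z X) Y W p)"
proof -
  have nabla_tor: "g (nabla U (tor V V')) W = D U (T V V' W) - T (nabla U W) V V'"
    if "U \<in> E" "V \<in> E" "V' \<in> E" for U V V'
    using that nabla_g[of U "tor V V'" W] T_cyclic[of "nabla U W" V V']
    by (simp add: T_def[symmetric] E_closed)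
  have tor_br: "g (tor U (br V V')) W = - T (br V V') U W"
    if "U \<in> E" "V \<in> E" "V' \<in> E" for U V V'
    using that T_skew12[of "br V V'" U W] by (simp add: T_def[symmetric] E_closed)
  have "g (R X Y Z) W + g (R Y Z X) W + g (R Z X Y) W =
      g (R X Y Z + R Y Z X + R Z X Y) W"
    by (simp add: g_add E_closed)
  also have "\<dots> = D X (T Y Z W) - T (nabla X W) Y Z + (D Y (T Z X W) - T (nabla Y W) Z X)
      + (D Z (T X Y W) - T (nabla Z W) X Y) - T (br Y Z) X W - T (br Z X) Y W - T (br X Y) Z W"
    by (simp add: bianchi_field g_add nabla_tor tor_br E_closed)
  finally show ?thesis
    using closed_DT[of X Y Z W p]
    by (simp add: fun_eq_iff T_br DT_nabla_first)
qed

text \<open>Adding the Bianchi identities of \<open>(X,Y,Z;V)\<close>, \<open>(X,Y,V;Z)\<close>, \<open>(Y,Z,V;X)\<close> and \<open>(Z,X,V;Y)\<close>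
  leaves twice the cyclic sum of \<open>R(V,X,Y,Z)\<close> on the left, and by closedness the quadratic
  torsion terms cancel on the right.\<close>

lemma DT_eq_cyclic_R:
  assumes [simp]: "X \<in> E" "Y \<in> E" "Z \<in> E" "V \<in> E"
  shows "DT V X Y Z p = g (R V X Y) Z p + g (R V Y Z) X p + g (R V Z X) Y p"
proof -
  \<comment> \<open>The Bianchi identity of \<open>(U,W,V;W')\<close>, rewritten so that its
    quadratic terms are invariant under cyclic permutations of \<open>U\<close>, \<open>W\<close>,
    \<open>W'\<close>.\<close>
  have step: "g (R V U W) W' p - g (R V W U) W' p - g (R U W W') V p
      = DT W' U W V p + T (tor U W) W' V p + T (tor W W') U V p + T (tor W' U) W V p"
    if [simp]: "U \<in> E" "W \<in> E" "W' \<in> E" for U W W'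
  proof -
    have "g (R U W V) W' p = - g (R U W W') V p"
      by (simp add: R_skew34[of U W W' V])
    moreover have "g (R W V U) W' p = - g (R V W U) W' p"
      by (simp add: R_skew12[of V W U] g_uminus E_closed)
    moreover have "T (tor U W) V W' p = - T (tor U W) W' V p"
      by (simp add: T_skew23[of "tor U W" W' V] E_closed)
    moreover have "T (tor W V) U W' p = - T (tor W' U) W V p"
      by (simp add: T_tor_sym[of U W' W V] T_tor_skew[of W' U W V])
    moreover have "T (tor V U) W W' p = - T (tor W W') U V p"
      by (simp add: T_tor_sym[of W W' V U] T_skew23[of "tor W W'" U V] E_closed)
    ultimately show ?thesis
      using bianchi[of U W V W' p] by simp
  qed
  have swap: "g (R V Y X) Z p = - g (R V Y Z) X p" "g (R V Z Y) X p = - g (R V Z X) Y p"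
    "g (R V X Z) Y p = - g (R V X Y) Z p"
    using R_skew34[of V Y Z X] R_skew34[of V Z X Y] R_skew34[of V X Y Z] by simp_all
  \<comment> \<open>The three instances of \<open>step\<close> contribute three copies of the
    quadratic terms, and \<open>bianchi\<close> removes one. By \<open>closed_DT\<close> the other
    two, together with the derivatives along \<open>X\<close>, \<open>Y\<close> and
    \<open>Z\<close>, make a second \<open>DT V X Y Z p\<close>.\<close>
  show ?thesis
    using step[OF assms(1-3)] step[OF assms(2,3,1)] step[OF assms(3,1,2)]
      bianchi[OF assms, of p] closed_DT[OF assms, of p] swap
    by argo
qed

end

section \<open>A parallel orthogonal almost complex structure and its Nijenhuis tensor\<close>

locale closed_skew_torsion_complex = closed_skew_torsion +
  fixes J
  assumes E_J: "X \<in> E \<Longrightarrow> J X \<in> E"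
    and J_J: "X \<in> E \<Longrightarrow> J (J X) = - X"
    and J_diff: "X \<in> E \<Longrightarrow> Y \<in> E \<Longrightarrow> J (X - Y) = J X - J Y"
    and g_J_J: "X \<in> E \<Longrightarrow> Y \<in> E \<Longrightarrow> g (J X) (J Y) = g X Y"
    and nabla_J: "X \<in> E \<Longrightarrow> Y \<in> E \<Longrightarrow> nabla X (J Y) = J (nabla X Y)"
begin

definition N :: "'a \<Rightarrow> 'a \<Rightarrow> 'a \<Rightarrow> 'b \<Rightarrow> real" where
  "N X Y Z = g (br (J X) (J Y) - br X Y - J (br (J X) Y) - J (br X (J Y))) Z"

lemma g_J_left: "X \<in> E \<Longrightarrow> Z \<in> E \<Longrightarrow> g (J X) Z = - g X (J Z)"
  using g_J_J[of X "J Z"] by (simp add: E_J J_J g_uminus_right E_closed minus_equation_iff)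

text \<open>Together with \<open>g_J_left\<close> this makes the last two arguments of the curvature
  of type (1,1).\<close>

lemma R_J: "X \<in> E \<Longrightarrow> Y \<in> E \<Longrightarrow> Z \<in> E \<Longrightarrow> R X Y (J Z) = J (R X Y Z)"
  by (simp add: R_def nabla_J J_diff E_J E_closed)

text \<open>Each bracket is a difference of covariant derivatives minus \<open>tor\<close>. Since
  \<open>J\<close> is parallel, the covariant derivatives cancel and only torsion remains.\<close>

lemma N_eq_T:
  assumes [simp]: "X \<in> E" "Y \<in> E" "Z \<in> E"
  shows "N X Y Z = T X Y Z - T (J X) (J Y) Z - T (J X) Y (J Z) - T X (J Y) (J Z)"
proof -
  have br: "br U V = nabla U V - nabla V U - tor U V" for U V
    by (simp add: tor_def)
  have "br (J X) (J Y) - br X Y - J (br (J X) Y) - J (br X (J Y)) =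
      tor X Y - tor (J X) (J Y) + J (tor (J X) Y) + J (tor X (J Y))"
    by (simp add: br nabla_J J_J J_diff E_J E_closed)
  then show ?thesis
    by (simp add: N_def T_def g_add g_diff g_J_left E_J E_closed)
qed

lemma nabla_N:
  assumes [simp]: "V \<in> E" "X \<in> E" "Y \<in> E" "Z \<in> E"
  shows "D V (N X Y Z) = N (nabla V X) Y Z + N X (nabla V Y) Z + N X Y (nabla V Z)"
proof
  fix p
  have R_J_pair: "g (R V U (J W)) W' = - g (R V U W) (J W')" if "U \<in> E" "W \<in> E" "W' \<in> E" for U W W'
    using that by (simp add: R_J g_J_left E_closed)
  \<comment> \<open>In the cyclic sums of the last three terms, those curvatures with
    \<open>J\<close> on both of their last two arguments add up to \<open>DT V X Y Z p\<close>; the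
    others cancel in pairs across the sums.\<close>
  have DT_0: "DT V X Y Z p - DT V (J X) (J Y) Z p - DT V (J X) Y (J Z) p - DT V X (J Y) (J Z) p = 0"
    by (simp add: DT_eq_cyclic_R R_J_pair J_J g_uminus_right E_J E_closed)
  have D_N: "D V (N X Y Z) =
      D V (T X Y Z) - D V (T (J X) (J Y) Z) - D V (T (J X) Y (J Z)) - D V (T X (J Y) (J Z))"
    by (simp add: N_eq_T D_diff C_T C_diff E_J)
  \<comment> \<open>As \<open>nabla V\<close> commutes with \<open>J\<close>, the derivative of
    \<open>N\<close> is the same combination of values of \<open>DT\<close> as \<open>N\<close> is
    of values of \<open>T\<close>, so \<open>DT_0\<close> is the claim.\<close>
  show "D V (N X Y Z) p = (N (nabla V X) Y Z + N X (nabla V Y) Z + N X Y (nabla V Z)) p"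
    unfolding D_N using DT_0 by (simp add: N_eq_T DT_def nabla_J E_J E_nabla)
qed

end

section \<open>Transfer to vector fields on the manifold\<close>

theorem proposition6p1:
  fixes A :: "('a::{t2_space, second_countable_topology}, real^8) chart set"
    and g :: "'a tensor2" and J :: "'a endo" and \<Psi> :: "'a cform4"
    and nabla :: "'a connection"
  assumes "smooth_atlas A"
    and "almost_hermitian A g J"
    and "su4_form A g J \<Psi>"
    and "torsion_connection A g J \<Psi> nabla"
    and "closed3 A (torsion g nabla)"
  shows "parallel3 A nabla (nijenhuis g J)"
proof -
  note A = assms(1)
  have g_sym: "g p u v = g p v u"
    and g_add: "w \<in> tangent_space A p \<Longrightarrow> g p u (v + w) = g p u v + g p u w"
    if "u \<in> tangent_space A p" "v \<in> tangent_space A p" for p u v w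
    using assms(2) that by (simp_all add: almost_hermitian_def riemannian_metric_def linear_on_tangent_def)
  have g_diff: "g p (u - v) w = g p u w - g p v w"
    if "u \<in> tangent_space A p" "v \<in> tangent_space A p" "w \<in> tangent_space A p" for p u v w
    \<comment> \<open>Linearity of the metric is given in the second argument, so
      \<open>u - v\<close> and \<open>v\<close> are added there and symmetry carries the result to
      the first.\<close>
    using g_add[of w p "u - v" v] that by (simp add: g_sym[of _ p w] minus_in_tangent_space)
  have J: "J p u \<in> tangent_space A p" "J p (J p u) = - u"
    and J_add: "v \<in> tangent_space A p \<Longrightarrow> J p (u + v) = J p u + J p v"
    and g_J: "v \<in> tangent_space A p \<Longrightarrow> g p (J p u) (J p v) = g p u v"
    if "u \<in> tangent_space A p" for p u v
    using assms(2) that by (simp_all add: almost_hermitian_def almost_complex_def)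
  have J_diff: "J p (u - v) = J p u - J p v"
    if "u \<in> tangent_space A p" "v \<in> tangent_space A p" for p u v
    using J_add[of "u - v" p v] that by (simp add: minus_in_tangent_space)
  have J_field: "endo_app J X \<in> vfields A" if "X \<in> vfields A" for X
    using assms(2) that by (simp add: almost_hermitian_def almost_complex_def)
  have g_smooth: "metric_app g X Y \<in> smooth_funs A" if "X \<in> vfields A" "Y \<in> vfields A" for X Y
    using assms(2) that by (simp add: almost_hermitian_def riemannian_metric_def)
  have nabla_field: "nabla X Y \<in> vfields A"
    and nabla_add_left: "Z \<in> vfields A \<Longrightarrow> nabla (X + Y) Z = nabla X Z + nabla Y Z"
    and nabla_add: "Z \<in> vfields A \<Longrightarrow> nabla X (Y + Z) = nabla X Y + nabla X Z"
    and nabla_J: "cov_endo J nabla X Y = 0"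
    if "X \<in> vfields A" "Y \<in> vfields A" for X Y Z
    using assms(4) that by (simp_all add: torsion_connection_def linear_connection_def)
  have nabla_g: "cov_metric g nabla X Y Z = 0"
    and skew: "torsion g nabla Y X Z = - torsion g nabla X Y Z"
      "torsion g nabla X Z Y = - torsion g nabla X Y Z"
    if "X \<in> vfields A" "Y \<in> vfields A" "Z \<in> vfields A" for X Y Z
    using assms(4) that unfolding torsion_connection_def totally_skew3_def by blast+
  interpret metric_connection "vfields A" "smooth_funs A" dirderiv lie_bracket "metric_app g" nabla
  proof unfold_locales
    show "nabla (X - Y) Z = nabla X Z - nabla Y Z"
      if "X \<in> vfields A" "Y \<in> vfields A" "Z \<in> vfields A" for X Y Z
      using nabla_add_left[of "X - Y" Y Z] that by (simp add: vfields_diff[OF A])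
    show "nabla X (Y - Z) = nabla X Y - nabla X Z"
      if "X \<in> vfields A" "Y \<in> vfields A" "Z \<in> vfields A" for X Y Z
      using nabla_add[of X "Y - Z" Z] that by (simp add: vfields_diff[OF A])
    show "dirderiv X (metric_app g Y Z) = metric_app g (nabla X Y) Z + metric_app g Y (nabla X Z)"
      if "X \<in> vfields A" "Y \<in> vfields A" "Z \<in> vfields A" for X Y Z
      using nabla_g[OF that] by (simp add: cov_metric_def algebra_simps)
    show "metric_app g X Y = metric_app g Y X" if "X \<in> vfields A" "Y \<in> vfields A" for X Y
      using that by (auto simp: metric_app_def intro!: g_sym vfields_tangent)
    show "metric_app g (X - Y) Z = metric_app g X Z - metric_app g Y Z"
      if "X \<in> vfields A" "Y \<in> vfields A" "Z \<in> vfields A" for X Y Z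
      using that by (simp add: metric_app_def fun_eq_iff g_diff vfields_tangent)
  qed (fact vfields_diff[OF A] vfields_lie_bracket[OF A] nabla_field g_smooth smooth_funs_diff[OF A]
      dirderiv_diff[OF A] dirderiv_add dirderiv_lie_bracket lie_bracket_skew lie_bracket_jacobi[OF A])+
  \<comment> \<open>The first interpretation makes \<open>T\<close> available. This identification
    lets the hypotheses on skew symmetry and closedness serve as axioms of the second one.\<close>
  have T: "T = torsion g nabla"
    by (simp add: fun_eq_iff T_def tor_def torsion_def)
  interpret closed_skew_torsion_complex "vfields A" "smooth_funs A" dirderiv lie_bracket
    "metric_app g" nabla "endo_app J"
  proof unfold_locales
    show "dirderiv X (T Y Z W) - dirderiv Y (T X Z W) + dirderiv Z (T X Y W) - dirderiv W (T X Y Z)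
      - T (lie_bracket X Y) Z W + T (lie_bracket X Z) Y W - T (lie_bracket X W) Y Z
      - T (lie_bracket Y Z) X W + T (lie_bracket Y W) X Z - T (lie_bracket Z W) X Y = 0"
      if "X \<in> vfields A" "Y \<in> vfields A" "Z \<in> vfields A" "W \<in> vfields A" for X Y Z W
      using assms(5) that unfolding T closed3_def ext_deriv3_def by blast
    show "T Y X Z = - T X Y Z" "T X Z Y = - T X Y Z"
      if "X \<in> vfields A" "Y \<in> vfields A" "Z \<in> vfields A" for X Y Z
      using skew[OF that] by (simp_all add: T)
    show "endo_app J X \<in> vfields A" if "X \<in> vfields A" for X
      using that by (rule J_field)
    show "endo_app J (endo_app J X) = - X" if "X \<in> vfields A" for X
      using that by (simp add: endo_app_def fun_eq_iff J vfields_tangent)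
    show "endo_app J (X - Y) = endo_app J X - endo_app J Y" if "X \<in> vfields A" "Y \<in> vfields A" for X Y
      using that by (simp add: endo_app_def fun_eq_iff J_diff vfields_tangent)
    show "metric_app g (endo_app J X) (endo_app J Y) = metric_app g X Y"
      if "X \<in> vfields A" "Y \<in> vfields A" for X Y
      using that by (simp add: metric_app_def endo_app_def g_J vfields_tangent)
    show "nabla X (endo_app J Y) = endo_app J (nabla X Y)" if "X \<in> vfields A" "Y \<in> vfields A" for X Y
      using nabla_J[OF that] by (simp add: cov_endo_def)
  qed
  have "nijenhuis g J = N"
    by (simp add: nijenhuis_def N_def fun_eq_iff)
  then show ?thesis
    by (simp add: parallel3_def cov_tensor3_def nabla_N)
qed

end
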